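(* For each integer $m \ge 2$, there exists a cyclically $4$-edge-connected cubic graph $G$ with $|V(G)| = 8m$ and circumference $c(G) = 7m+2$.
   Context: The circumference $c(G)$ of a graph $G$ is the length of a longest cycle in $G$. A graph is cyclically $k$-edge-connected if at least $k$ edges must be removed to disconnect it into components among which at least two contain a cycle. *)

theory Defs
  imports Main
begin

definition simple_graph :: "'a set \<Rightarrow> 'a set set \<Rightarrow> bool" where
  "simple_graph V E \<longleftrightarrow> finite V \<and> (\<forall>e\<in>E. e \<subseteq> V \<and> card e = 2)"

definition cubic_graph :: "'a set \<Rightarrow> 'a set set \<Rightarrow> bool" where
  "cubic_graph V E \<longleftrightarrow> simple_graph V E \<and> (\<forall>v\<in>V. card {e \<in> E. v \<in> e} = 3)"

text \<open>A cycle is given by the cyclic sequence of its pairwise distinct vertices, so its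
  number of edges is the length of the list. Edges are vertex sets, hence the vertices of
  a cycle automatically belong to the graph.\<close>

definition is_cycle :: "'a set set \<Rightarrow> 'a list \<Rightarrow> bool" where
  "is_cycle E xs \<longleftrightarrow> length xs \<ge> 3 \<and> distinct xs \<and>
     (\<forall>i<length xs. {xs ! i, xs ! (Suc i mod length xs)} \<in> E)"

text \<open>Meaningful only for finite graphs with at least one cycle (such as nonempty
  cubic graphs): otherwise the maximum is unspecified.\<close>

definition circumference :: "'a set set \<Rightarrow> nat" where
  "circumference E = Max (length ` {xs. is_cycle E xs})"

definition components :: "'a set \<Rightarrow> 'a set set \<Rightarrow> 'a set set" where
  "components V E = (\<lambda>u. {v \<in> V. (u, v) \<in> {(x, y). {x, y} \<in> E}\<^sup>*}) ` V"

definition contains_cycle :: "'a set set \<Rightarrow> 'a set \<Rightarrow> bool" where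
  "contains_cycle E C \<longleftrightarrow> (\<exists>xs. is_cycle E xs \<and> set xs \<subseteq> C)"

text \<open>The edge set \<open>F\<close> may be empty, so for \<open>k > 0\<close> the graph itself has at most one
  component containing a cycle. In particular such a cubic graph is connected.\<close>

definition cyclically_edge_connected :: "nat \<Rightarrow> 'a set \<Rightarrow> 'a set set \<Rightarrow> bool" where
  "cyclically_edge_connected k V E \<longleftrightarrow>
     (\<forall>F\<subseteq>E. (\<exists>C\<in>components V (E - F). \<exists>D\<in>components V (E - F).
          C \<noteq> D \<and> contains_cycle (E - F) C \<and> contains_cycle (E - F) D)
        \<longrightarrow> k \<le> card F)"

end

theory Submission
  imports Defs
begin

text \<open>
  Deleting two adjacent vertices \<open>u\<close>, \<open>v\<close> from the Petersen graph leaves a tile with two left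
  terminals (the former neighbours of \<open>u\<close>) and two right terminals (those of \<open>v\<close>). The graph is
  a ring of \<open>m\<close> tiles, the right terminals of each being joined to the left terminals of the next.

  If a cycle visits all eight vertices of a tile, then inside the tile no part of it connects a
  left link with a right link: otherwise contracting the rest of the ring onto \<open>u\<close> and \<open>v\<close> would
  produce a Hamiltonian cycle of the Petersen graph. So a fully visited tile cuts the cycle into
  a left and a right side, and three such tiles would disconnect it. Hence at most two tiles are
  fully visited, which bounds the length by \<open>7 m + 2\<close>. A cycle that turns back inside two
  neighbouring tiles and crosses each of the others twice, missing one vertex each time, attains
  the bound.

  For cyclic connectivity it suffices that every edge cut with at least two vertices on both
  sides has at least four edges. A tile that meets both sides contributes at least two edges, and
  so does a link between tiles on different sides; what remains is a single divided tile with
  the rest of the ring on one side.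
\<close>

section \<open>Cyclic index arithmetic\<close>

definition cpred :: "nat \<Rightarrow> nat \<Rightarrow> nat" where
  "cpred n i = (if i = 0 then n - 1 else i - 1)"

lemma cpred_less: "i < n \<Longrightarrow> cpred n i < n"
  by (auto simp: cpred_def)

lemma Suc_mod_eq_iff:
  "i < n \<Longrightarrow> j < n \<Longrightarrow> Suc j mod n = i \<longleftrightarrow> j = cpred n i"
  by (auto simp: cpred_def mod_Suc)

lemma Suc_mod_cpred: "i < n \<Longrightarrow> Suc (cpred n i) mod n = i"
  by (simp add: Suc_mod_eq_iff cpred_less)

lemma cyclic_induct:
  assumes "i < n" "P i" "\<And>j. j < n \<Longrightarrow> P j \<Longrightarrow> P (Suc j mod n)" "k < n"
  shows "P k"
proof -
  have "P ((i + d) mod n)" for d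
  proof (induction d)
    case 0
    then show ?case using assms by simp
  next
    case (Suc d)
    have "P (Suc ((i + d) mod n) mod n)"
      using Suc assms(1,3) by simp
    then show ?case by (simp add: mod_Suc_eq)
  qed
  \<comment> \<open>This number of steps leads from \<open>i\<close> past \<open>n - 1\<close> to
    \<open>0\<close> and on to \<open>k\<close>.\<close>
  from this[of "n - i + k"] show ?thesis
    using assms(1,4) by simp
qed

text \<open>Keeps the vertex label \<open>1\<close> a numeral like the other labels, so that facts
  about \<open>vx i 1\<close> still match after simplification.\<close>

declare One_nat_def [simp del]

section \<open>The edge set of a cycle\<close>

definition cycle_edges :: "'a list \<Rightarrow> 'a set set" where
  "cycle_edges xs = {{xs ! i, xs ! (Suc i mod length xs)} | i. i < length xs}"

lemma cycle_edges_subset: "is_cycle E xs \<Longrightarrow> cycle_edges xs \<subseteq> E"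
  by (auto simp: is_cycle_def cycle_edges_def)

text \<open>A vertex lies on the edges to its successor and its predecessor; length at least 3 makes
  these two positions, and hence the two edges, different.\<close>

lemma card_cycle_edges_incident:
  assumes "is_cycle E xs" "v \<in> set xs"
  shows "card {e \<in> cycle_edges xs. v \<in> e} = 2"
proof -
  define n where "n = length xs"
  have n: "n \<ge> 3" and d: "distinct xs"
    using assms by (auto simp: is_cycle_def n_def)
  obtain i where i: "i < n" "v = xs ! i"
    using assms(2) by (auto simp: in_set_conv_nth n_def)
  have inj: "xs ! a = xs ! b \<longleftrightarrow> a = b" if "a < n" "b < n" for a b
    using d that by (simp add: nth_eq_iff_index_eq n_def)
  let ?s = "Suc i mod n" and ?p = "cpred n i"
  have lt: "?s < n" "?p < n" using n i(1) by (auto simp: cpred_less)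
  have neq: "?s \<noteq> i" "?p \<noteq> i" "?s \<noteq> ?p"
    using n i(1) by (auto simp: cpred_def mod_Suc split: if_splits)
  have "{e \<in> cycle_edges xs. v \<in> e} = {{xs ! i, xs ! ?s}, {xs ! ?p, xs ! i}}" (is "?L = ?R")
  proof
    show "?L \<subseteq> ?R"
    proof
      fix e assume "e \<in> ?L"
      then obtain j where j: "j < n" "e = {xs ! j, xs ! (Suc j mod n)}" "xs ! i \<in> e"
        by (auto simp: cycle_edges_def n_def i)
      have "Suc j mod n < n" using n by simp
      then have "j = i \<or> Suc j mod n = i" using j inj i(1) by auto
      then show "e \<in> ?R"
      proof
        assume "Suc j mod n = i"
        then have "j = ?p" using Suc_mod_eq_iff[OF i(1) j(1)] by blast
        then have "e = {xs ! ?p, xs ! i}" using j(2) \<open>Suc j mod n = i\<close> by simp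
        then show ?thesis by blast
      qed (use j(2) in blast)
    qed
    show "?R \<subseteq> ?L"
    proof -
      have "{xs ! j, xs ! (Suc j mod n)} \<in> cycle_edges xs" if "j < n" for j
        using that by (auto simp: cycle_edges_def n_def)
      from this[OF i(1)] this[OF lt(2)] show ?thesis
        by (simp add: i Suc_mod_cpred)
    qed
  qed
  moreover have "{xs ! i, xs ! ?s} \<noteq> {xs ! ?p, xs ! i}"
    using inj lt i(1) neq by (auto simp: doubleton_eq_iff)
  ultimately show ?thesis by simp
qed

text \<open>The only form of connectedness used below: a contradiction arises from a set closed
  under cycle edges that contains some but not all vertices of the cycle.\<close>

lemma cycle_connected:
  assumes "is_cycle E xs"
    and closed: "\<And>x y. {x, y} \<in> cycle_edges xs \<Longrightarrow> x \<in> S \<Longrightarrow> y \<in> S"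
    and "v \<in> set xs" "v \<in> S"
  shows "set xs \<subseteq> S"
proof
  fix w assume "w \<in> set xs"
  obtain i where i: "i < length xs" "v = xs ! i"
    using assms(3) by (auto simp: in_set_conv_nth)
  obtain k where k: "k < length xs" "w = xs ! k"
    using \<open>w \<in> set xs\<close> by (auto simp: in_set_conv_nth)
  have "xs ! k \<in> S"
  proof (rule cyclic_induct[where P = "\<lambda>j. xs ! j \<in> S", OF i(1) _ _ k(1)])
    show "xs ! i \<in> S" using assms i by simp
    show "xs ! (Suc j mod length xs) \<in> S" if "j < length xs" "xs ! j \<in> S" for j
      by (rule closed[OF _ that(2)]) (use that in \<open>auto simp: cycle_edges_def\<close>)
  qed
  then show "w \<in> S" by (simp add: k)
qed

lemma is_cycleI_successively:
  assumes "length xs \<ge> 3" "distinct xs" "successively (\<lambda>x y. {x, y} \<in> E) xs"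
    "{last xs, hd xs} \<in> E"
  shows "is_cycle E xs"
  unfolding is_cycle_def
proof (intro conjI allI impI assms)
  fix i assume i: "i < length xs"
  show "{xs ! i, xs ! (Suc i mod length xs)} \<in> E"
  proof (cases "Suc i = length xs")
    case True
    then have "xs \<noteq> []" "i = length xs - 1" "Suc i mod length xs = 0" by auto
    then show ?thesis using assms(4) by (simp add: last_conv_nth hd_conv_nth)
  next
    case False
    then show ?thesis using assms(3) i
      by (simp add: successively_conv_nth)
  qed
qed

section \<open>A ring of Petersen fragments\<close>

definition vx :: "nat \<Rightarrow> nat \<Rightarrow> nat" where
  "vx i r = 8 * i + r"

lemma vx_eq_iff: "r < 8 \<Longrightarrow> s < 8 \<Longrightarrow> vx i r = vx j s \<longleftrightarrow> i = j \<and> r = s"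
  unfolding vx_def by presburger

text \<open>In a tile, \<open>0, 1\<close> are the left and \<open>2, 3\<close> the right terminals; \<open>4, 5, 6, 7\<close> are the common
  neighbours of the pairs \<open>02\<close>, \<open>03\<close>, \<open>12\<close>, \<open>13\<close>.\<close>

definition tile_edges :: "(nat \<times> nat) set" where
  "tile_edges = {(0,4), (0,5), (1,6), (1,7), (2,4), (2,6), (3,5), (3,7), (4,7), (5,6)}"

definition ring_verts :: "nat \<Rightarrow> nat set" where
  "ring_verts m = {vx i r | i r. i < m \<and> r < 8}"

definition ring_edges :: "nat \<Rightarrow> nat set set" where
  "ring_edges m =
     {{vx i r, vx i s} | i r s. i < m \<and> (r, s) \<in> tile_edges} \<union>
     {{vx i 2, vx (Suc i mod m) 0} | i. i < m} \<union>
     {{vx i 3, vx (Suc i mod m) 1} | i. i < m}"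

lemma less_8_cases:
  fixes r :: nat
  assumes "r < 8"
  obtains "r = 0" | "r = 1" | "r = 2" | "r = 3" | "r = 4" | "r = 5" | "r = 6" | "r = 7"
proof -
  have "r = 0 \<or> r = 1 \<or> r = 2 \<or> r = 3 \<or> r = 4 \<or> r = 5 \<or> r = 6 \<or> r = 7"
    using assms by presburger
  then show ?thesis using that by blast
qed

lemma ring_verts_eq: "ring_verts m = {..<8 * m}"
proof -
  have "x \<in> ring_verts m" if "x < 8 * m" for x
  proof -
    have "x = vx (x div 8) (x mod 8)" "x div 8 < m"
      using that by (auto simp: vx_def)
    then show ?thesis unfolding ring_verts_def by fastforce
  qed
  then show ?thesis by (auto simp: ring_verts_def vx_def)
qed

text \<open>The link at terminal \<open>r\<close> seen from tile \<open>i\<close>. Each link thus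
  has two names, as a right spoke of one tile and as a left spoke of the next.\<close>

definition spoke_edge :: "nat \<Rightarrow> nat \<Rightarrow> nat \<Rightarrow> nat set" where
  "spoke_edge m i r =
     (if r = 0 then {vx (cpred m i) 2, vx i 0}
      else if r = 1 then {vx (cpred m i) 3, vx i 1}
      else if r = 2 then {vx i 2, vx (Suc i mod m) 0}
      else {vx i 3, vx (Suc i mod m) 1})"

text \<open>Tile edges keep the endpoint order of \<open>tile_edges\<close>, so that the memberships
  at a vertex are literally the Boolean values \<open>h r s\<close> of the tile analysis.\<close>

definition incident :: "nat \<Rightarrow> nat \<Rightarrow> nat \<Rightarrow> nat set set" where
  "incident m i r = [
     {{vx i 0, vx i 4}, {vx i 0, vx i 5}, spoke_edge m i 0},
     {{vx i 1, vx i 6}, {vx i 1, vx i 7}, spoke_edge m i 1},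
     {{vx i 2, vx i 4}, {vx i 2, vx i 6}, spoke_edge m i 2},
     {{vx i 3, vx i 5}, {vx i 3, vx i 7}, spoke_edge m i 3},
     {{vx i 0, vx i 4}, {vx i 2, vx i 4}, {vx i 4, vx i 7}},
     {{vx i 0, vx i 5}, {vx i 3, vx i 5}, {vx i 5, vx i 6}},
     {{vx i 1, vx i 6}, {vx i 2, vx i 6}, {vx i 5, vx i 6}},
     {{vx i 1, vx i 7}, {vx i 3, vx i 7}, {vx i 4, vx i 7}}] ! r"

lemma tile_edge_in:
  assumes "i < m" "(r, s) \<in> tile_edges"
  shows "{vx i r, vx i s} \<in> ring_edges m" "{vx i s, vx i r} \<in> ring_edges m"
  using assms by (auto simp: ring_edges_def insert_commute)

lemma tile_edges_in:
  assumes "i < m"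
  shows
    "{vx i 0, vx i 4} \<in> ring_edges m"
    "{vx i 4, vx i 0} \<in> ring_edges m"
    "{vx i 0, vx i 5} \<in> ring_edges m"
    "{vx i 5, vx i 0} \<in> ring_edges m"
    "{vx i 1, vx i 6} \<in> ring_edges m"
    "{vx i 6, vx i 1} \<in> ring_edges m"
    "{vx i 1, vx i 7} \<in> ring_edges m"
    "{vx i 7, vx i 1} \<in> ring_edges m"
    "{vx i 2, vx i 4} \<in> ring_edges m"
    "{vx i 4, vx i 2} \<in> ring_edges m"
    "{vx i 2, vx i 6} \<in> ring_edges m"
    "{vx i 6, vx i 2} \<in> ring_edges m"
    "{vx i 3, vx i 5} \<in> ring_edges m"
    "{vx i 5, vx i 3} \<in> ring_edges m"
    "{vx i 3, vx i 7} \<in> ring_edges m"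
    "{vx i 7, vx i 3} \<in> ring_edges m"
    "{vx i 4, vx i 7} \<in> ring_edges m"
    "{vx i 7, vx i 4} \<in> ring_edges m"
    "{vx i 5, vx i 6} \<in> ring_edges m"
    "{vx i 6, vx i 5} \<in> ring_edges m"
  by (simp_all add: assms tile_edges_def tile_edge_in)

lemma link_edge_in:
  "i < m \<Longrightarrow> {vx i 2, vx (Suc i mod m) 0} \<in> ring_edges m"
  "i < m \<Longrightarrow> {vx i 3, vx (Suc i mod m) 1} \<in> ring_edges m"
  unfolding ring_edges_def by blast+

lemma spoke_edge_in: "i < m \<Longrightarrow> spoke_edge m i r \<in> ring_edges m"
  using link_edge_in[of "cpred m i" m] link_edge_in[of i m]
  by (simp add: spoke_edge_def Suc_mod_cpred cpred_less)

lemma ring_edges_cases: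
  assumes "e \<in> ring_edges m"
  obtains i r s where "i < m" "(r, s) \<in> tile_edges" "e = {vx i r, vx i s}"
  | i where "i < m" "e = {vx i 2, vx (Suc i mod m) 0}"
  | i where "i < m" "e = {vx i 3, vx (Suc i mod m) 1}"
  using assms unfolding ring_edges_def by blast

lemma ring_edges_incident:
  assumes "i < m" "r < 8"
  shows "{e \<in> ring_edges m. vx i r \<in> e} = incident m i r"
proof
  show "{e \<in> ring_edges m. vx i r \<in> e} \<subseteq> incident m i r"
  proof clarify
    fix e assume e: "e \<in> ring_edges m" "vx i r \<in> e"
    from e(1) show "e \<in> incident m i r"
    proof (cases rule: ring_edges_cases)
      case (1 j p q)
      then have "j = i \<and> (r = p \<or> r = q)"
        using e(2) assms by (auto simp: tile_edges_def vx_eq_iff)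
      with 1 show ?thesis
        by (elim conjE disjE) (auto simp: tile_edges_def incident_def)
    next
      case (2 j)
      then have "i = j \<and> r = 2 \<or> i = Suc j mod m \<and> r = 0"
        using e(2) assms(2) by (simp add: vx_eq_iff)
      then show ?thesis
      proof (elim disjE conjE)
        assume "i = Suc j mod m" "r = 0"
        then have "j = cpred m i"
          using Suc_mod_eq_iff[OF assms(1) 2(1)] by blast
        then have "e = spoke_edge m i 0"
          using 2(2) assms(1) by (simp add: spoke_edge_def Suc_mod_cpred)
        then show ?thesis using \<open>r = 0\<close> by (simp add: incident_def)
      qed (use 2(2) in \<open>simp add: incident_def spoke_edge_def\<close>)
    next
      case (3 j)
      then have "i = j \<and> r = 3 \<or> i = Suc j mod m \<and> r = 1"
        using e(2) assms(2) by (simp add: vx_eq_iff)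
      then show ?thesis
      proof (elim disjE conjE)
        assume "i = Suc j mod m" "r = 1"
        then have "j = cpred m i"
          using Suc_mod_eq_iff[OF assms(1) 3(1)] by blast
        then have "e = spoke_edge m i 1"
          using 3(2) assms(1) by (simp add: spoke_edge_def Suc_mod_cpred)
        then show ?thesis using \<open>r = 1\<close> by (simp add: incident_def)
      qed (use 3(2) in \<open>simp add: incident_def spoke_edge_def\<close>)
    qed
  qed
  show "incident m i r \<subseteq> {e \<in> ring_edges m. vx i r \<in> e}"
    using assms(2)
    by (cases rule: less_8_cases)
      (simp_all add: incident_def tile_edges_in[OF assms(1)] spoke_edge_in[OF assms(1)],
       simp_all add: spoke_edge_def)
qed

lemma card_incident:
  assumes "m \<ge> 2" "i < m" "r < 8"
  shows "card (incident m i r) = 3"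
  using assms(3)
  by (cases rule: less_8_cases)
    (simp_all add: incident_def spoke_edge_def doubleton_eq_iff vx_eq_iff card_insert_if)

lemma cubic_ring:
  assumes "m \<ge> 2"
  shows "cubic_graph (ring_verts m) (ring_edges m)"
proof -
  have "e \<subseteq> ring_verts m \<and> card e = 2" if "e \<in> ring_edges m" for e
    using that
  proof (cases rule: ring_edges_cases)
    case (1 i r s)
    then have "r < 8" "s < 8" "r \<noteq> s" by (auto simp: tile_edges_def)
    with 1 show ?thesis by (auto simp: ring_verts_def vx_eq_iff)
  next
    case (2 i)
    then have "Suc i mod m < m" by simp
    with 2 show ?thesis unfolding ring_verts_def by (fastforce simp: vx_eq_iff)
  next
    case (3 i)
    then have "Suc i mod m < m" by simp
    with 3 show ?thesis unfolding ring_verts_def by (fastforce simp: vx_eq_iff)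
  qed
  moreover have "card {e \<in> ring_edges m. v \<in> e} = 3" if "v \<in> ring_verts m" for v
    using that assms by (auto simp: ring_verts_def ring_edges_incident card_incident)
  ultimately show ?thesis
    by (auto simp: cubic_graph_def simple_graph_def ring_verts_eq)
qed

section \<open>A long cycle\<close>

text \<open>Traverses tiles \<open>j, ..., j + n\<close> from the first to the second left terminal of tile \<open>j\<close>,
  skipping vertex 4 in all tiles but the last.\<close>

fun detour :: "nat \<Rightarrow> nat \<Rightarrow> nat list" where
  "detour 0 j = map (vx j) [0, 5, 3, 7, 4, 2, 6, 1]"
| "detour (Suc n) j = map (vx j) [0, 5, 6, 2] @ detour n (Suc j) @ map (vx j) [3, 7, 1]"

lemma detour_ends: "detour n j \<noteq> []" "hd (detour n j) = vx j 0" "last (detour n j) = vx j 1"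
  by (cases n; simp)+

lemma length_detour: "length (detour n j) = 7 * n + 8"
  by (induction n j rule: detour.induct) auto

lemma set_detour: "set (detour n j) \<subseteq> {8 * j..}"
  by (induction n j rule: detour.induct) (auto simp: vx_def)

lemma distinct_detour: "distinct (detour n j)"
proof (induction n j rule: detour.induct)
  case (1 j)
  show ?case by (simp add: vx_def)
next
  case (2 n j)
  have "vx j r \<notin> set (detour n (Suc j))" if "r < 8" for r
    using set_detour[of n "Suc j"] that by (auto simp: vx_def)
  with 2 show ?case by (simp add: vx_eq_iff)
qed

lemma successively_detour:
  "j + n < m \<Longrightarrow> successively (\<lambda>x y. {x, y} \<in> ring_edges m) (detour n j)"
proof (induction n j rule: detour.induct)
  case (1 j)
  then show ?case
    by (simp add: tile_edges_in)
next
  case (2 n j)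
  then have j: "j < m" "Suc j mod m = Suc j" by auto
  have "{vx j 2, vx (Suc j) 0} \<in> ring_edges m" "{vx (Suc j) 1, vx j 3} \<in> ring_edges m"
    using link_edge_in[OF j(1)] by (simp_all add: j(2) insert_commute)
  with 2 j(1) show ?case
    by (simp add: successively_append_iff successively_Cons detour_ends tile_edges_in)
qed

lemma ex_long_cycle:
  assumes "m \<ge> 2"
  shows "\<exists>xs. is_cycle (ring_edges m) xs \<and> length xs = 7 * m + 2"
proof -
  \<comment> \<open>The first eight vertices form a Hamiltonian path of tile 0 between its right
    terminals; the detour covers tiles 1 to \<open>m - 1\<close>. The length is 8 + (7 (m - 2) + 8)
    = 7 m + 2.\<close>
  define xs where "xs = map (vx 0) [3, 5, 0, 4, 7, 1, 6, 2] @ detour (m - 2) 1"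
  have "{vx 0 2, vx 1 0} \<in> ring_edges m" "{vx 0 3, vx 1 1} \<in> ring_edges m"
    using link_edge_in[of 0 m] assms by (simp_all add: One_nat_def)
  moreover have "vx 0 r \<notin> set (detour (m - 2) 1)" if "r < 8" for r
    using set_detour[of "m - 2" 1] that by (auto simp: vx_def)
  moreover have "successively (\<lambda>x y. {x, y} \<in> ring_edges m) (detour (m - 2) 1)"
    by (rule successively_detour) (use assms in simp)
  ultimately have "is_cycle (ring_edges m) xs"
    using assms unfolding xs_def
    by (intro is_cycleI_successively)
      (simp_all add: length_detour distinct_detour vx_eq_iff successively_append_iff
        successively_Cons detour_ends
        tile_edges_in insert_commute)
  moreover have "length xs = 7 * m + 2"
    using assms by (simp add: xs_def length_detour)
  ultimately show ?thesis by blast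
qed

section \<open>Upper bound for the circumference\<close>

text \<open>Degree two at a cubic vertex as a Boolean condition, which makes the analysis of a tile
  purely propositional.\<close>

definition two_of :: "bool \<Rightarrow> bool \<Rightarrow> bool \<Rightarrow> bool" where
  "two_of p q r \<longleftrightarrow> \<not> p \<and> q \<and> r \<or> p \<and> \<not> q \<and> r \<or> p \<and> q \<and> \<not> r"

lemma two_ofI:
  assumes "distinct [a, b, c]" "card (H \<inter> {a, b, c}) = 2"
  shows "two_of (a \<in> H) (b \<in> H) (c \<in> H)"
  using assms unfolding two_of_def
  by (cases "a \<in> H"; cases "b \<in> H"; cases "c \<in> H") auto

text \<open>The edges missing from a spanning subgraph of degree two form a perfect matching of the
  tile with its four outgoing edges. The last four alternatives each leave a closed 5-cycle.\<close>

lemma tile_two_factors: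
  fixes h :: "nat \<Rightarrow> nat \<Rightarrow> bool" and t :: "nat \<Rightarrow> bool"
  assumes "two_of (h 0 4) (h 0 5) (t 0)" "two_of (h 1 6) (h 1 7) (t 1)"
    "two_of (h 2 4) (h 2 6) (t 2)" "two_of (h 3 5) (h 3 7) (t 3)"
    "two_of (h 0 4) (h 2 4) (h 4 7)" "two_of (h 0 5) (h 3 5) (h 5 6)"
    "two_of (h 1 6) (h 2 6) (h 5 6)" "two_of (h 1 7) (h 3 7) (h 4 7)"
  shows "\<not> t 2 \<and> \<not> t 3 \<or> \<not> t 0 \<and> \<not> t 1 \<or>
     \<not> h 0 4 \<and> \<not> h 2 6 \<and> \<not> h 1 7 \<and> \<not> h 3 5 \<or>
     \<not> h 0 5 \<and> \<not> h 3 7 \<and> \<not> h 1 6 \<and> \<not> h 2 4 \<or>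
     \<not> t 0 \<and> \<not> t 2 \<and> \<not> h 4 7 \<and> \<not> h 1 6 \<and> \<not> h 3 5 \<or>
     \<not> t 0 \<and> \<not> t 3 \<and> \<not> h 5 6 \<and> \<not> h 1 7 \<and> \<not> h 2 4 \<or>
     \<not> t 1 \<and> \<not> t 2 \<and> \<not> h 5 6 \<and> \<not> h 0 4 \<and> \<not> h 3 7 \<or>
     \<not> t 1 \<and> \<not> t 3 \<and> \<not> h 4 7 \<and> \<not> h 0 5 \<and> \<not> h 2 6"
  using assms unfolding two_of_def
  by (cases "h 0 4"; cases "h 0 5"; cases "h 2 4"; cases "h 3 5"; simp; auto)

lemma tile_split:
  fixes h :: "nat \<Rightarrow> nat \<Rightarrow> bool" and t :: "nat \<Rightarrow> bool"
  assumes "two_of (h 0 4) (h 0 5) (t 0)" "two_of (h 1 6) (h 1 7) (t 1)"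
    "two_of (h 2 4) (h 2 6) (t 2)" "two_of (h 3 5) (h 3 7) (t 3)"
    "two_of (h 0 4) (h 2 4) (h 4 7)" "two_of (h 0 5) (h 3 5) (h 5 6)"
    "two_of (h 1 6) (h 2 6) (h 5 6)" "two_of (h 1 7) (h 3 7) (h 4 7)"
  obtains
    (split) X where "\<And>r s. (r, s) \<in> tile_edges \<Longrightarrow> h r s \<Longrightarrow> r \<in> X \<longleftrightarrow> s \<in> X"
      "t 0 \<Longrightarrow> 0 \<in> X" "t 1 \<Longrightarrow> 1 \<in> X" "t 2 \<Longrightarrow> 2 \<notin> X" "t 3 \<Longrightarrow> 3 \<notin> X"
  | (closed) Y r s where "\<And>r s. (r, s) \<in> tile_edges \<Longrightarrow> h r s \<Longrightarrow> r \<in> Y \<longleftrightarrow> s \<in> Y"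
      "\<And>r. r < 4 \<Longrightarrow> r \<in> Y \<Longrightarrow> \<not> t r" "r \<in> Y" "r < 8" "s \<notin> Y" "s < 8"
proof -
  from tile_two_factors[of h t, OF assms] show ?thesis
  proof (elim disjE)
    assume "\<not> t 2 \<and> \<not> t 3"
    then show ?thesis by (intro split[of UNIV]) auto
  next
    assume "\<not> t 0 \<and> \<not> t 1"
    then show ?thesis by (intro split[of "{}"]) auto
  next
    assume "\<not> h 0 4 \<and> \<not> h 2 6 \<and> \<not> h 1 7 \<and> \<not> h 3 5"
    then show ?thesis by (intro split[of "{0, 1, 5, 6}"]) (auto simp: tile_edges_def)
  next
    assume "\<not> h 0 5 \<and> \<not> h 3 7 \<and> \<not> h 1 6 \<and> \<not> h 2 4"
    then show ?thesis by (intro split[of "{0, 1, 4, 7}"]) (auto simp: tile_edges_def)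
  next
    assume "\<not> t 0 \<and> \<not> t 2 \<and> \<not> h 4 7 \<and> \<not> h 1 6 \<and> \<not> h 3 5"
    then show ?thesis by (intro closed[of "{0, 2, 4, 5, 6}" 0 1]) (auto simp: tile_edges_def)
  next
    assume "\<not> t 0 \<and> \<not> t 3 \<and> \<not> h 5 6 \<and> \<not> h 1 7 \<and> \<not> h 2 4"
    then show ?thesis by (intro closed[of "{0, 3, 4, 5, 7}" 0 1]) (auto simp: tile_edges_def)
  next
    assume "\<not> t 1 \<and> \<not> t 2 \<and> \<not> h 5 6 \<and> \<not> h 0 4 \<and> \<not> h 3 7"
    then show ?thesis by (intro closed[of "{1, 2, 4, 6, 7}" 1 0]) (auto simp: tile_edges_def)
  next
    assume "\<not> t 1 \<and> \<not> t 3 \<and> \<not> h 4 7 \<and> \<not> h 0 5 \<and> \<not> h 2 6"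
    then show ?thesis by (intro closed[of "{1, 3, 5, 6, 7}" 1 0]) (auto simp: tile_edges_def)
  qed
qed

section \<open>From split tiles to closed arcs of the ring\<close>

lemma tile_edges_less: "(r, s) \<in> tile_edges \<Longrightarrow> r < 8 \<and> s < 8"
  by (auto simp: tile_edges_def)

text \<open>Stating the hypotheses as equivalences allows each kind of edge to be checked in one
  orientation only.\<close>

lemma ring_closedI:
  assumes "H \<subseteq> ring_edges m"
    and "\<And>i r s. i < m \<Longrightarrow> (r, s) \<in> tile_edges \<Longrightarrow> {vx i r, vx i s} \<in> H \<Longrightarrow>
      vx i r \<in> S \<longleftrightarrow> vx i s \<in> S"
    and "\<And>i. i < m \<Longrightarrow> {vx i 2, vx (Suc i mod m) 0} \<in> H \<Longrightarrow>
      vx i 2 \<in> S \<longleftrightarrow> vx (Suc i mod m) 0 \<in> S"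
    and "\<And>i. i < m \<Longrightarrow> {vx i 3, vx (Suc i mod m) 1} \<in> H \<Longrightarrow>
      vx i 3 \<in> S \<longleftrightarrow> vx (Suc i mod m) 1 \<in> S"
    and "{x, y} \<in> H" "x \<in> S"
  shows "y \<in> S"
proof -
  have "{x, y} \<in> ring_edges m" using assms by blast
  then show ?thesis
  proof (cases rule: ring_edges_cases)
    case (1 i r s)
    then have "vx i r \<in> S \<longleftrightarrow> vx i s \<in> S" using assms(2)[of i r s] assms(5) by simp
    with 1(3) assms(6) show ?thesis by (metis doubleton_eq_iff)
  next
    case (2 i)
    then have "vx i 2 \<in> S \<longleftrightarrow> vx (Suc i mod m) 0 \<in> S" using assms(3)[of i] assms(5) by simp
    with 2(2) assms(6) show ?thesis by (metis doubleton_eq_iff)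
  next
    case (3 i)
    then have "vx i 3 \<in> S \<longleftrightarrow> vx (Suc i mod m) 1 \<in> S" using assms(4)[of i] assms(5) by simp
    with 3(2) assms(6) show ?thesis by (metis doubleton_eq_iff)
  qed
qed

text \<open>No used edge joins \<open>X\<close> to its complement in the tile, used left links end
  in \<open>X\<close> and used right links end outside it. The links are indexed by
  \<open>j\<close>, not named as spokes, to fit \<open>ring_closedI\<close>.\<close>

definition splits :: "nat set set \<Rightarrow> nat \<Rightarrow> nat \<Rightarrow> nat set \<Rightarrow> bool" where
  "splits H m i X \<longleftrightarrow>
     (\<forall>r s. (r, s) \<in> tile_edges \<longrightarrow> {vx i r, vx i s} \<in> H \<longrightarrow> (r \<in> X \<longleftrightarrow> s \<in> X)) \<and>
     (\<forall>j<m. {vx j 2, vx (Suc j mod m) 0} \<in> H \<longrightarrow>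
        (j = i \<longrightarrow> 2 \<notin> X) \<and> (Suc j mod m = i \<longrightarrow> 0 \<in> X)) \<and>
     (\<forall>j<m. {vx j 3, vx (Suc j mod m) 1} \<in> H \<longrightarrow>
        (j = i \<longrightarrow> 3 \<notin> X) \<and> (Suc j mod m = i \<longrightarrow> 1 \<in> X))"

lemma two_of_incident:
  assumes "m \<ge> 2" "is_cycle (ring_edges m) xs" "i < m" "r < 8" "vx i r \<in> set xs"
    and "incident m i r = {a, b, c}"
  shows "two_of (a \<in> cycle_edges xs) (b \<in> cycle_edges xs) (c \<in> cycle_edges xs)"
proof (rule two_ofI)
  have "card {a, b, c} = 3"
    using card_incident[OF assms(1,3,4)] assms(6) by simp
  then show "distinct [a, b, c]"
    by (auto simp: card_insert_if split: if_splits)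
  have "{e \<in> cycle_edges xs. vx i r \<in> e} = cycle_edges xs \<inter> {a, b, c}"
    using cycle_edges_subset[OF assms(2)] ring_edges_incident[OF assms(3,4)] assms(6) by blast
  then show "card (cycle_edges xs \<inter> {a, b, c}) = 2"
    using card_cycle_edges_incident[OF assms(2,5)] by simp
qed

text \<open>The degree conditions at the eight vertices feed \<open>tile_split\<close>. The outcome
  \<open>closed\<close> is impossible: the cycle would be confined to the copy of \<open>Y\<close>
  in tile \<open>i\<close>, yet it visits the vertex \<open>q\<close> outside
  \<open>Y\<close>.\<close>

lemma full_tile_splits:
  assumes "m \<ge> 2" "is_cycle (ring_edges m) xs" "i < m" "\<forall>r<8. vx i r \<in> set xs"
  shows "\<exists>X. splits (cycle_edges xs) m i X"
proof -
  let ?H = "cycle_edges xs"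
  note two = two_of_incident[OF assms(1-3)]
  have link: "spoke_edge m i 2 = {vx j 2, vx (Suc j mod m) 0}"
    "spoke_edge m i 3 = {vx j 3, vx (Suc j mod m) 1}" if "j = i" for j
    unfolding that by (simp_all add: spoke_edge_def)
  have link': "spoke_edge m i 0 = {vx j 2, vx (Suc j mod m) 0}"
    "spoke_edge m i 1 = {vx j 3, vx (Suc j mod m) 1}" if "j < m" "Suc j mod m = i" for j
  proof -
    have "j = cpred m i" using that Suc_mod_eq_iff[OF assms(3) that(1)] by blast
    then show "spoke_edge m i 0 = {vx j 2, vx (Suc j mod m) 0}"
      "spoke_edge m i 1 = {vx j 3, vx (Suc j mod m) 1}"
      using assms(3) by (simp_all add: spoke_edge_def Suc_mod_cpred)
  qed
  show ?thesis
  proof (rule tile_split[of "\<lambda>r s. {vx i r, vx i s} \<in> ?H" "\<lambda>r. spoke_edge m i r \<in> ?H"])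
    show "two_of ({vx i 0, vx i 4} \<in> ?H) ({vx i 0, vx i 5} \<in> ?H) (spoke_edge m i 0 \<in> ?H)"
      by (rule two[of 0]) (simp_all add: assms incident_def)
    show "two_of ({vx i 1, vx i 6} \<in> ?H) ({vx i 1, vx i 7} \<in> ?H) (spoke_edge m i 1 \<in> ?H)"
      by (rule two[of 1]) (simp_all add: assms incident_def)
    show "two_of ({vx i 2, vx i 4} \<in> ?H) ({vx i 2, vx i 6} \<in> ?H) (spoke_edge m i 2 \<in> ?H)"
      by (rule two[of 2]) (simp_all add: assms incident_def)
    show "two_of ({vx i 3, vx i 5} \<in> ?H) ({vx i 3, vx i 7} \<in> ?H) (spoke_edge m i 3 \<in> ?H)"
      by (rule two[of 3]) (simp_all add: assms incident_def)
    show "two_of ({vx i 0, vx i 4} \<in> ?H) ({vx i 2, vx i 4} \<in> ?H) ({vx i 4, vx i 7} \<in> ?H)"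
      by (rule two[of 4]) (simp_all add: assms incident_def)
    show "two_of ({vx i 0, vx i 5} \<in> ?H) ({vx i 3, vx i 5} \<in> ?H) ({vx i 5, vx i 6} \<in> ?H)"
      by (rule two[of 5]) (simp_all add: assms incident_def)
    show "two_of ({vx i 1, vx i 6} \<in> ?H) ({vx i 2, vx i 6} \<in> ?H) ({vx i 5, vx i 6} \<in> ?H)"
      by (rule two[of 6]) (simp_all add: assms incident_def)
    show "two_of ({vx i 1, vx i 7} \<in> ?H) ({vx i 3, vx i 7} \<in> ?H) ({vx i 4, vx i 7} \<in> ?H)"
      by (rule two[of 7]) (simp_all add: assms incident_def)
  next
    fix X
    assume X: "\<And>r s. (r, s) \<in> tile_edges \<Longrightarrow> {vx i r, vx i s} \<in> ?H \<Longrightarrow> r \<in> X \<longleftrightarrow> s \<in> X"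
      "spoke_edge m i 0 \<in> ?H \<Longrightarrow> 0 \<in> X" "spoke_edge m i 1 \<in> ?H \<Longrightarrow> 1 \<in> X"
      "spoke_edge m i 2 \<in> ?H \<Longrightarrow> 2 \<notin> X" "spoke_edge m i 3 \<in> ?H \<Longrightarrow> 3 \<notin> X"
    have "splits ?H m i X"
      unfolding splits_def by (intro conjI allI impI; metis X link link')
    then show ?thesis by blast
  next
    fix Y p q
    assume Y: "\<And>r s. (r, s) \<in> tile_edges \<Longrightarrow> {vx i r, vx i s} \<in> ?H \<Longrightarrow> r \<in> Y \<longleftrightarrow> s \<in> Y"
      "\<And>r. r < 4 \<Longrightarrow> r \<in> Y \<Longrightarrow> spoke_edge m i r \<notin> ?H"
      and pq: "p \<in> Y" "p < 8" "q \<notin> Y" "q < 8"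
    let ?S = "vx i ` (Y \<inter> {..<8})"
    have S: "vx j r \<in> ?S \<longleftrightarrow> j = i \<and> r \<in> Y" if "r < 8" for j r
      using that by (auto simp: vx_eq_iff)
    have "set xs \<subseteq> ?S"
    proof (rule cycle_connected[OF assms(2)])
      show "vx i p \<in> set xs" "vx i p \<in> ?S" using assms(4) pq by auto
      fix x y assume xy: "{x, y} \<in> ?H" "x \<in> ?S"
      show "y \<in> ?S"
      proof (rule ring_closedI[OF cycle_edges_subset[OF assms(2)] _ _ _ xy])
        show "vx j r \<in> ?S \<longleftrightarrow> vx j s \<in> ?S"
          if "(r, s) \<in> tile_edges" "{vx j r, vx j s} \<in> ?H" for j r s
          using that Y(1)[of r s] tile_edges_less[of r s] S by auto
        show "vx j 2 \<in> ?S \<longleftrightarrow> vx (Suc j mod m) 0 \<in> ?S"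
          if "j < m" "{vx j 2, vx (Suc j mod m) 0} \<in> ?H" for j
          using that Y(2)[of 2] Y(2)[of 0] link(1)[of j] link'(1)[of j] by (auto simp: S)
        show "vx j 3 \<in> ?S \<longleftrightarrow> vx (Suc j mod m) 1 \<in> ?S"
          if "j < m" "{vx j 3, vx (Suc j mod m) 1} \<in> ?H" for j
          using that Y(2)[of 3] Y(2)[of 1] link(2)[of j] link'(2)[of j] by (auto simp: S)
      qed
    qed
    then have "vx i q \<in> ?S" using assms(4) pq(4) by blast
    then show ?thesis using S pq by auto
  qed
qed

text \<open>The arc of the ring from the right side of the split in tile \<open>p\<close> to the
  left side of the split in tile \<open>q\<close>.\<close>

definition between :: "nat \<Rightarrow> nat set \<Rightarrow> nat \<Rightarrow> nat set \<Rightarrow> nat set" where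
  "between p X q Y =
     {vx i r | i r. r < 8 \<and> (p < i \<and> i < q \<or> i = p \<and> r \<notin> X \<or> i = q \<and> r \<in> Y)}"

lemma vx_in_between:
  "r < 8 \<Longrightarrow> vx i r \<in> between p X q Y \<longleftrightarrow>
     p < i \<and> i < q \<or> i = p \<and> r \<notin> X \<or> i = q \<and> r \<in> Y"
  unfolding between_def by (auto simp: vx_eq_iff)

text \<open>The arc could be left only across one of the two splits, which no cycle edge crosses.
  The link from tile \<open>m - 1\<close> to tile 0 meets the end tiles, if at all, on the sides
  outside the arc.\<close>

lemma between_closed:
  assumes cyc: "is_cycle (ring_edges m) xs" and pq: "p < q" "q < m"
    and X: "splits (cycle_edges xs) m p X" and Y: "splits (cycle_edges xs) m q Y"
    and xy: "{x, y} \<in> cycle_edges xs" "x \<in> between p X q Y"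
  shows "y \<in> between p X q Y"
proof (rule ring_closedI[OF cycle_edges_subset[OF cyc] _ _ _ xy])
  show "vx i r \<in> between p X q Y \<longleftrightarrow> vx i s \<in> between p X q Y"
    if "(r, s) \<in> tile_edges" "{vx i r, vx i s} \<in> cycle_edges xs" for i r s
    using that X Y tile_edges_less[OF that(1)] by (auto simp: vx_in_between splits_def)
  show "vx i 2 \<in> between p X q Y \<longleftrightarrow> vx (Suc i mod m) 0 \<in> between p X q Y"
    if i: "i < m" "{vx i 2, vx (Suc i mod m) 0} \<in> cycle_edges xs" for i
  proof -
    have "i = p \<Longrightarrow> 2 \<notin> X" "i = q \<Longrightarrow> 2 \<notin> Y" "Suc i mod m = p \<Longrightarrow> 0 \<in> X" "Suc i mod m = q \<Longrightarrow> 0 \<in> Y"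
      using X Y i by (auto simp: splits_def)
    then show ?thesis using pq i(1)
      by (auto simp: vx_in_between mod_Suc split: if_splits)
  qed
  show "vx i 3 \<in> between p X q Y \<longleftrightarrow> vx (Suc i mod m) 1 \<in> between p X q Y"
    if i: "i < m" "{vx i 3, vx (Suc i mod m) 1} \<in> cycle_edges xs" for i
  proof -
    have "i = p \<Longrightarrow> 3 \<notin> X" "i = q \<Longrightarrow> 3 \<notin> Y" "Suc i mod m = p \<Longrightarrow> 1 \<in> X" "Suc i mod m = q \<Longrightarrow> 1 \<in> Y"
      using X Y i by (auto simp: splits_def)
    then show ?thesis using pq i(1)
      by (auto simp: vx_in_between mod_Suc split: if_splits)
  qed
qed

text \<open>Depending on whether 0 is in \<open>Y\<close>, the visited vertex \<open>vx q 0\<close>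
  lies in the arc from \<open>p\<close> to \<open>q\<close> or in that from \<open>q\<close> to
  \<open>k\<close>. The cycle would stay in that arc and miss the third full tile.\<close>

lemma no_three_full_tiles:
  assumes "m \<ge> 2" and cyc: "is_cycle (ring_edges m) xs" and "p < q" "q < k" "k < m"
    and full: "\<And>i r. i \<in> {p, q, k} \<Longrightarrow> r < 8 \<Longrightarrow> vx i r \<in> set xs"
  shows False
proof -
  have "\<exists>X. splits (cycle_edges xs) m i X" if "i \<in> {p, q, k}" for i
    using full_tile_splits[of m xs i] that assms by auto
  then obtain X Y Z where XYZ: "splits (cycle_edges xs) m p X" "splits (cycle_edges xs) m q Y"
    "splits (cycle_edges xs) m k Z"
    by (meson insertCI)
  have 1: "vx q 0 \<notin> between p X q Y"
  proof
    assume "vx q 0 \<in> between p X q Y"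
    then have "set xs \<subseteq> between p X q Y"
      using between_closed[OF cyc _ _ XYZ(1,2)] assms full
      by (intro cycle_connected[OF cyc, where v = "vx q 0"]) auto
    then have "vx k 0 \<in> between p X q Y" using full by auto
    then show False using assms by (auto simp: vx_in_between)
  qed
  have 2: "vx q 0 \<notin> between q Y k Z"
  proof
    assume "vx q 0 \<in> between q Y k Z"
    then have "set xs \<subseteq> between q Y k Z"
      using between_closed[OF cyc _ _ XYZ(2,3)] assms full
      by (intro cycle_connected[OF cyc, where v = "vx q 0"]) auto
    then have "vx p 0 \<in> between q Y k Z" using full by auto
    then show False using assms by (auto simp: vx_in_between)
  qed
  show False using 1 2 assms by (auto simp: vx_in_between)
qed

section \<open>Counting the visited vertices tile by tile\<close>

lemma card_ge_3_imp_chain: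
  fixes A :: "'a::linorder set"
  assumes "card A \<ge> 3"
  obtains p q k where "p \<in> A" "q \<in> A" "k \<in> A" "p < q" "q < k"
proof -
  have fin: "finite A" and ne: "A \<noteq> {}" using assms by (auto intro: card_ge_0_finite)
  have "\<not> A \<subseteq> {Min A, Max A}"
  proof
    assume "A \<subseteq> {Min A, Max A}"
    then have "card A \<le> card {Min A, Max A}" by (intro card_mono) auto
    also have "\<dots> \<le> 2" by (simp add: card_insert_if)
    finally show False using assms by simp
  qed
  then obtain q where q: "q \<in> A" "q \<noteq> Min A" "q \<noteq> Max A" by blast
  then have "Min A < q" "q < Max A"
    using fin by (simp_all add: order.strict_iff_order)
  with q(1) fin ne show ?thesis using that[of "Min A" q "Max A"] by simp
qed

lemma cycle_verts:
  assumes "simple_graph V E" "is_cycle E xs"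
  shows "set xs \<subseteq> V"
proof
  fix v assume "v \<in> set xs"
  then obtain i where "i < length xs" "v = xs ! i" by (auto simp: in_set_conv_nth)
  then have "{v, xs ! (Suc i mod length xs)} \<in> E" using assms(2) by (auto simp: is_cycle_def)
  then show "v \<in> V" using assms(1) by (auto simp: simple_graph_def)
qed

lemma cycle_length_le:
  assumes "m \<ge> 2" and cyc: "is_cycle (ring_edges m) xs"
  shows "length xs \<le> 7 * m + 2"
proof -
  let ?T = "\<lambda>i. vx i ` {..<8}"
  let ?full = "\<lambda>i. \<forall>r<8. vx i r \<in> set xs"
  let ?F = "{i \<in> {..<m}. ?full i}"
  have cardT: "card (?T i) = 8" for i
    by (subst card_image) (auto simp: inj_on_def vx_eq_iff)
  have "set xs \<subseteq> ring_verts m"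
    using cycle_verts cyc cubic_ring[OF assms(1)] by (auto simp: cubic_graph_def)
  then have "set xs = (\<Union>i<m. set xs \<inter> ?T i)"
    unfolding ring_verts_def by blast
  then have "length xs = card (\<Union>i<m. set xs \<inter> ?T i)"
    using cyc distinct_card[of xs] by (simp add: is_cycle_def)
  also have "\<dots> \<le> (\<Sum>i<m. card (set xs \<inter> ?T i))"
    by (rule card_UN_le) simp
  \<comment> \<open>A tile that is not full misses at least one of its eight vertices.\<close>
  also have "\<dots> \<le> (\<Sum>i<m. 7 + of_bool (?full i))"
  proof (rule sum_mono)
    fix i
    show "card (set xs \<inter> ?T i) \<le> 7 + of_bool (?full i)"
    proof (cases "?full i")
      case True
      have "card (set xs \<inter> ?T i) \<le> card (?T i)" by (rule card_mono) auto
      with True show ?thesis by (simp add: cardT)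
    next
      case False
      then have "card (set xs \<inter> ?T i) < card (?T i)" by (intro psubset_card_mono) auto
      with False show ?thesis by (simp add: cardT)
    qed
  qed
  also have "\<dots> = 7 * m + card ?F"
    by (simp add: sum.distrib sum_of_bool_eq Int_def)
  also have "card ?F \<le> 2"
  proof (rule ccontr)
    assume "\<not> card ?F \<le> 2"
    then have "card ?F \<ge> 3" by simp
    then obtain p q k where "p \<in> ?F" "q \<in> ?F" "k \<in> ?F" "p < q" "q < k"
      by (rule card_ge_3_imp_chain)
    then show False using no_three_full_tiles[OF assms, of p q k] by auto
  qed
  finally show ?thesis by simp
qed

lemma circumference_ring:
  assumes "m \<ge> 2"
  shows "circumference (ring_edges m) = 7 * m + 2"
  unfolding circumference_def
proof (rule Max_eqI)
  \<comment> \<open>\<open>Max\<close> needs a finite set; the length bound itself supplies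
    this.\<close>
  show "finite (length ` {xs. is_cycle (ring_edges m) xs})"
    by (rule finite_subset[of _ "{..7 * m + 2}"]) (auto dest: cycle_length_le[OF assms])
  show "7 * m + 2 \<in> length ` {xs. is_cycle (ring_edges m) xs}"
    using ex_long_cycle[OF assms] by force
qed (auto dest: cycle_length_le[OF assms])

section \<open>Edge cuts\<close>

definition edge_cut :: "'a set set \<Rightarrow> 'a set \<Rightarrow> 'a set set" where
  "edge_cut E S = {e \<in> E. \<exists>x y. e = {x, y} \<and> x \<in> S \<and> y \<notin> S}"

lemma doubleton_in_edge_cut: "{x, y} \<in> edge_cut E S \<longleftrightarrow> {x, y} \<in> E \<and> (x \<in> S) \<noteq> (y \<in> S)"
  by (auto simp: edge_cut_def doubleton_eq_iff)

text \<open>\<open>b\<close> tells on which side of a cut each tile vertex lies. Bounds on this sum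
  are finite checks over the colourings of eight vertices.\<close>

definition tile_cut :: "(nat \<Rightarrow> bool) \<Rightarrow> nat" where
  "tile_cut b = (\<Sum>(r, s)\<in>tile_edges. of_bool (b r \<noteq> b s))"

lemma tile_cut_eq:
  "tile_cut b = of_bool (b 0 \<noteq> b 4) + of_bool (b 0 \<noteq> b 5) + of_bool (b 1 \<noteq> b 6) +
     of_bool (b 1 \<noteq> b 7) + of_bool (b 2 \<noteq> b 4) + of_bool (b 2 \<noteq> b 6) + of_bool (b 3 \<noteq> b 5) +
     of_bool (b 3 \<noteq> b 7) + of_bool (b 4 \<noteq> b 7) + of_bool (b 5 \<noteq> b 6)"
  by (simp add: tile_cut_def tile_edges_def)

lemma sum_lessThan_8:
  "(\<Sum>r<8. f (r::nat)) = f 0 + f 1 + f 2 + f 3 + f 4 + f 5 + f 6 + (f 7 :: nat)"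
  by (simp add: eval_nat_numeral One_nat_def)

lemma sum_lessThan_4: "(\<Sum>r<4. f (r::nat)) = f 0 + f 1 + f 2 + (f 3 :: nat)"
  by (simp add: eval_nat_numeral One_nat_def)

text \<open>A tile is connected and has no bridge.\<close>

lemma tile_cut_ge_2:
  assumes "r < 8" "b r \<noteq> b 0"
  shows "2 \<le> tile_cut b"
proof -
  have "\<not> (b 1 = b 0 \<and> b 2 = b 0 \<and> b 3 = b 0 \<and> b 4 = b 0 \<and> b 5 = b 0 \<and> b 6 = b 0 \<and> b 7 = b 0)"
    using assms by (auto elim: less_8_cases)
  then show ?thesis
    unfolding tile_cut_eq
    by (cases "b 0"; cases "b 1"; cases "b 2"; cases "b 3"; cases "b 4"; cases "b 5"; cases "b 6";
        cases "b 7"; simp)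
qed

text \<open>With the two deleted vertices restored on side \<open>\<beta>\<close>, this says that a
  cut of the Petersen graph with at least two vertices on each side has at least four edges. The
  second sum counts the cut edges at the terminals.\<close>

lemma tile_cut_ge_4:
  assumes "2 \<le> (\<Sum>r<8. of_bool (b r \<noteq> \<beta>) :: nat)"
  shows "4 \<le> tile_cut b + (\<Sum>r<4. of_bool (b r \<noteq> \<beta>))"
  using assms unfolding tile_cut_eq sum_lessThan_8 sum_lessThan_4
  by (cases \<beta>; cases "b 0"; cases "b 1"; cases "b 2"; cases "b 3"; cases "b 4"; cases "b 5";
      cases "b 6"; cases "b 7"; simp)

section \<open>Edge cuts of the ring, split into tile edges and links\<close>

definition tile_edge_set :: "nat \<Rightarrow> nat set set" where
  "tile_edge_set i = (\<lambda>(r, s). {vx i r, vx i s}) ` tile_edges"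

definition links :: "nat \<Rightarrow> nat \<Rightarrow> nat set set" where
  "links m i = {{vx i 2, vx (Suc i mod m) 0}, {vx i 3, vx (Suc i mod m) 1}}"

lemma tile_edge_in_tile: "e \<in> tile_edge_set i \<Longrightarrow> e \<subseteq> vx i ` {..<8}"
  by (auto simp: tile_edge_set_def dest: tile_edges_less)

lemma tiles_disjoint: "i \<noteq> j \<Longrightarrow> vx i ` {..<8} \<inter> vx j ` {..<8} = {}"
  by (auto simp: vx_eq_iff)

lemma tile_edge_sets_disjoint:
  assumes "i \<noteq> j"
  shows "tile_edge_set i \<inter> tile_edge_set j = {}"
proof -
  have False if e: "e \<in> tile_edge_set i" "e \<in> tile_edge_set j" for e
  proof -
    obtain x where "x \<in> e" using e(1) by (auto simp: tile_edge_set_def)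
    then have "x \<in> vx i ` {..<8}" "x \<in> vx j ` {..<8}" using e tile_edge_in_tile by blast+
    with tiles_disjoint[OF assms] show False by blast
  qed
  then show ?thesis by blast
qed

lemma tile_edge_set_links_disjoint:
  assumes "m \<ge> 2" "j < m"
  shows "tile_edge_set i \<inter> links m j = {}"
proof -
  have "Suc j mod m \<noteq> j" using assms by (simp add: mod_Suc)
  then show ?thesis
    using tile_edge_in_tile[of _ i] unfolding links_def by (fastforce simp: vx_eq_iff)
qed

lemma card_links: "card (links m i) = 2"
  by (simp add: links_def doubleton_eq_iff vx_eq_iff)

text \<open>Labels 2 and 3 mark the end of a link in the tile where it starts, so even for
  \<open>m = 2\<close> the two pairs of links stay apart.\<close>

lemma links_disjoint: "i \<noteq> j \<Longrightarrow> links m i \<inter> links m j = {}"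
  by (simp add: links_def doubleton_eq_iff vx_eq_iff)

lemma card_tile_cut:
  assumes "i < m"
  shows "card (edge_cut (ring_edges m) S \<inter> tile_edge_set i) = tile_cut (\<lambda>r. vx i r \<in> S)"
proof -
  let ?f = "\<lambda>(r, s). {vx i r, vx i s}"
  let ?A = "{p \<in> tile_edges. case p of (r, s) \<Rightarrow> (vx i r \<in> S) \<noteq> (vx i s \<in> S)}"
  have fin: "finite tile_edges" by (simp add: tile_edges_def)
  have "inj_on ?f tile_edges"
    by (simp add: tile_edges_def doubleton_eq_iff vx_eq_iff)
  then have "inj_on ?f ?A" by (rule inj_on_subset) blast
  moreover have "edge_cut (ring_edges m) S \<inter> tile_edge_set i = ?f ` ?A"
    using tile_edge_in(1)[OF assms] by (auto simp: tile_edge_set_def doubleton_in_edge_cut)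
  ultimately have "card (edge_cut (ring_edges m) S \<inter> tile_edge_set i) = card ?A"
    by (simp add: card_image)
  also have "\<dots> = tile_cut (\<lambda>r. vx i r \<in> S)"
    unfolding tile_cut_def using fin
    by (simp add: sum_of_bool_eq case_prod_unfold Int_def)
  finally show ?thesis .
qed

lemma finite_ring_edges: "finite (ring_edges m)"
proof (rule finite_subset)
  show "ring_edges m \<subseteq> (\<Union>i<m. tile_edge_set i \<union> links m i)"
    unfolding ring_edges_def tile_edge_set_def links_def by fastforce
  show "finite (\<Union>i<m. tile_edge_set i \<union> links m i)"
    by (simp add: tile_edge_set_def links_def tile_edges_def)
qed

lemma finite_edge_cut: "finite (edge_cut (ring_edges m) S)"
  by (rule finite_subset[OF _ finite_ring_edges[of m]]) (auto simp: edge_cut_def)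

text \<open>As \<open>m\<close> is at least 2, the far ends of the four spokes lie in other tiles,
  all on side \<open>\<beta>\<close>. A spoke is therefore cut exactly when its terminal in tile
  \<open>i\<close> is on the other side.\<close>

lemma card_spoke_cut:
  assumes "m \<ge> 2" "i < m"
    and outside: "\<And>j. j < m \<Longrightarrow> j \<noteq> i \<Longrightarrow> \<forall>r<8. (vx j r \<in> S) = \<beta>"
  shows "card (edge_cut (ring_edges m) S \<inter> (links m i \<union> links m (cpred m i))) =
    (\<Sum>r<4. of_bool ((vx i r \<in> S) \<noteq> \<beta>))"
proof -
  have neq: "cpred m i \<noteq> i" "Suc i mod m \<noteq> i"
    using assms(1,2) by (auto simp: cpred_def mod_Suc)
  have out: "vx (cpred m i) r \<in> S \<longleftrightarrow> \<beta>" "vx (Suc i mod m) r \<in> S \<longleftrightarrow> \<beta>" if "r < 8" for r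
    using outside[of "cpred m i"] outside[of "Suc i mod m"] neq that assms(2)
    by (auto simp: cpred_less)
  have inj: "inj_on (spoke_edge m i) {..<4}"
  proof -
    have "{..<4::nat} = {0, 1, 2, 3}" by auto
    then show ?thesis using neq by (simp add: spoke_edge_def doubleton_eq_iff vx_eq_iff)
  qed
  have spokes: "links m i \<union> links m (cpred m i) = spoke_edge m i ` {..<4}"
  proof -
    have "{..<4::nat} = {0, 1, 2, 3}" by auto
    then show ?thesis
      using assms(2) by (auto simp: links_def spoke_edge_def Suc_mod_cpred)
  qed
  have mem: "spoke_edge m i r \<in> edge_cut (ring_edges m) S \<longleftrightarrow> (vx i r \<in> S) \<noteq> \<beta>" if "r < 4" for r
  proof -
    have r: "r = 0 \<or> r = 1 \<or> r = 2 \<or> r = 3" using that by presburger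
    have "spoke_edge m i r \<in> ring_edges m" by (rule spoke_edge_in[OF assms(2)])
    with r show ?thesis
      by (elim disjE) (auto simp: spoke_edge_def doubleton_in_edge_cut out)
  qed
  have "edge_cut (ring_edges m) S \<inter> (links m i \<union> links m (cpred m i)) =
    spoke_edge m i ` {r \<in> {..<4}. (vx i r \<in> S) \<noteq> \<beta>}"
    using mem unfolding spokes by blast
  moreover have "inj_on (spoke_edge m i) {r \<in> {..<4}. (vx i r \<in> S) \<noteq> \<beta>}"
    by (rule inj_on_subset[OF inj]) blast
  ultimately have "card (edge_cut (ring_edges m) S \<inter> (links m i \<union> links m (cpred m i))) =
    card {r \<in> {..<4}. (vx i r \<in> S) \<noteq> \<beta>}"
    by (simp only: card_image)
  then show ?thesis by (simp add: sum_of_bool_eq Int_def)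
qed

text \<open>Divided tiles and link pairs between undivided tiles on different sides are disjoint
  sources of two cut edges each, so at most one source exists. Without divided tiles, the side would
  change an even number of times around the ring, hence never. With one divided tile, all others
  agree and \<open>tile_cut_ge_4\<close> applies.\<close>

lemma small_cut_trivial:
  assumes m: "m \<ge> 2" and S: "S \<subseteq> ring_verts m" and small: "card (edge_cut (ring_edges m) S) < 4"
  shows "card S \<le> 1 \<or> card (ring_verts m - S) \<le> 1"
proof -
  let ?D = "edge_cut (ring_edges m) S"
  define const where "const i \<longleftrightarrow> (\<forall>r<8. (vx i r \<in> S) = (vx i 0 \<in> S))" for i
  have no_two: False if "A \<subseteq> ?D" "B \<subseteq> ?D" "A \<inter> B = {}" "2 \<le> card A" "2 \<le> card B" for A B
  proof -
    have "finite A" "finite B" using that finite_edge_cut finite_subset by blast+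
    then have "card A + card B = card (A \<union> B)" using that(3) by (simp add: card_Un_disjoint)
    also have "\<dots> \<le> card ?D" using that finite_edge_cut by (intro card_mono) auto
    finally show False using small that by simp
  qed
  have tile: "2 \<le> card (?D \<inter> tile_edge_set i)" if "i < m" "\<not> const i" for i
    using that tile_cut_ge_2[of _ "\<lambda>r. vx i r \<in> S"] by (auto simp: card_tile_cut const_def)
  have link: "links m i \<subseteq> ?D"
    if "i < m" "const i" "const (Suc i mod m)" "(vx i 0 \<in> S) \<noteq> (vx (Suc i mod m) 0 \<in> S)" for i
  proof -
    have "vx i r \<in> S \<longleftrightarrow> vx i 0 \<in> S" "vx (Suc i mod m) r \<in> S \<longleftrightarrow> vx (Suc i mod m) 0 \<in> S"
      if "r < 8" for r
      using that \<open>const i\<close> \<open>const (Suc i mod m)\<close> unfolding const_def by blast+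
    from this[of 2] this[of 3] this[of 0] this[of 1] that(4) show ?thesis
      using link_edge_in[OF that(1)] by (simp add: links_def doubleton_in_edge_cut)
  qed
  show ?thesis
  proof (cases "\<forall>i<m. const i")
    case True
    then have c: "const i" "const (Suc i mod m)" if "i < m" for i using that m by auto
    have step: "\<exists>j<m. (vx j 0 \<in> S) = b \<and> (vx (Suc j mod m) 0 \<in> S) \<noteq> b"
      if "i < m" "k < m" "(vx i 0 \<in> S) = b" "(vx k 0 \<in> S) \<noteq> b" for i k b
      using cyclic_induct[of i m "\<lambda>j. (vx j 0 \<in> S) = b" k] that by blast
    have "vx i 0 \<in> S \<longleftrightarrow> vx 0 0 \<in> S" if i: "i < m" for i
    proof (rule ccontr)
      assume neq: "\<not> ?thesis"
      let ?b = "vx 0 0 \<in> S"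
      have "0 < m" using m by simp
      then obtain j where j: "j < m" "(vx j 0 \<in> S) = ?b" "(vx (Suc j mod m) 0 \<in> S) \<noteq> ?b"
        using step[of 0 i ?b] i neq by blast
      \<comment> \<open>On the way from tile \<open>i\<close> back to tile 0 the side must change
        back. As \<open>j\<close> and \<open>k\<close> lie on different sides, two distinct link
        pairs are cut.\<close>
      obtain k where k: "k < m" "(vx k 0 \<in> S) \<noteq> ?b" "(vx (Suc k mod m) 0 \<in> S) = ?b"
        using step[of i 0 "\<not> ?b"] \<open>0 < m\<close> i neq by blast
      have "j \<noteq> k" using j k by blast
      then show False
        using no_two[of "links m j" "links m k"] link[OF j(1) c[OF j(1)]] link[OF k(1) c[OF k(1)]]
          j k links_disjoint[of j k] by (simp add: card_links)
    qed
    with c(1) have "v \<in> S \<longleftrightarrow> vx 0 0 \<in> S" if "v \<in> ring_verts m" for v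
      using that unfolding ring_verts_def const_def by blast
    with S have "S = {} \<or> ring_verts m - S = {}" by blast
    then show ?thesis by (metis card.empty zero_le)
  next
    case False
    then obtain i where i: "i < m" "\<not> const i" by blast
    have const: "const j" if "j < m" "j \<noteq> i" for j
    proof (rule ccontr)
      assume "\<not> const j"
      then show False
        using no_two[of "?D \<inter> tile_edge_set i" "?D \<inter> tile_edge_set j"] tile[OF i] tile[OF that(1)]
          tile_edge_sets_disjoint[of i j] that by blast
    qed
    \<comment> \<open>The tile after \<open>i\<close> fixes the common side. The induction starts at
      \<open>i\<close>, where the claim is vacuous, and any later change of side would cut a link
      pair in addition to the divided tile.\<close>
    define \<beta> where "\<beta> = (vx (Suc i mod m) 0 \<in> S)"
    have same: "j \<noteq> i \<longrightarrow> (vx j 0 \<in> S) = \<beta>" if "j < m" for j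
    proof (rule cyclic_induct[of i m "\<lambda>j. j \<noteq> i \<longrightarrow> (vx j 0 \<in> S) = \<beta>", OF i(1) _ _ that])
      show "i \<noteq> i \<longrightarrow> (vx i 0 \<in> S) = \<beta>" by simp
      fix j assume j: "j < m" "j \<noteq> i \<longrightarrow> (vx j 0 \<in> S) = \<beta>"
      show "Suc j mod m \<noteq> i \<longrightarrow> (vx (Suc j mod m) 0 \<in> S) = \<beta>"
      proof (cases "j = i")
        case True
        then show ?thesis by (simp add: \<beta>_def)
      next
        case False
        show ?thesis
        proof (rule ccontr)
          assume n: "\<not> ?thesis"
          have "Suc j mod m < m" using m by simp
          then have "links m j \<subseteq> ?D"
            using n j False link[of j] const[of j] const[of "Suc j mod m"] by blast
          then show False
            using no_two[of "?D \<inter> tile_edge_set i" "links m j"] tile[OF i]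
              tile_edge_set_links_disjoint[OF m j(1), of i] by (auto simp: card_links)
        qed
      qed
    qed
    have outside: "\<forall>r<8. (vx j r \<in> S) = \<beta>" if "j < m" "j \<noteq> i" for j
      using const[OF that] same[OF that(1)] that(2) unfolding const_def by blast
    let ?A = "?D \<inter> tile_edge_set i" and ?B = "?D \<inter> (links m i \<union> links m (cpred m i))"
    have "?A \<inter> ?B = {}"
      using tile_edge_set_links_disjoint[OF m i(1), of i]
        tile_edge_set_links_disjoint[OF m cpred_less[OF i(1)], of i] by blast
    then have "card ?A + card ?B = card (?A \<union> ?B)"
      by (simp add: card_Un_disjoint finite_edge_cut)
    also have "\<dots> \<le> card ?D" by (intro card_mono finite_edge_cut) auto
    finally have "tile_cut (\<lambda>r. vx i r \<in> S) + (\<Sum>r<4. of_bool ((vx i r \<in> S) \<noteq> \<beta>)) < 4"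
      using small card_tile_cut[OF i(1)] card_spoke_cut[OF m i(1) outside] by simp
    then have "(\<Sum>r<8. of_bool ((vx i r \<in> S) \<noteq> \<beta>) :: nat) \<le> 1"
      using tile_cut_ge_4[of "\<lambda>r. vx i r \<in> S" \<beta>] by linarith
    then have one: "card {r \<in> {..<8}. (vx i r \<in> S) \<noteq> \<beta>} \<le> 1"
      by (simp add: sum_of_bool_eq Int_def)
    \<comment> \<open>Outside tile \<open>i\<close> every vertex is on side \<open>\<beta>\<close>,
      so the other side has at most one vertex.\<close>
    have "{v \<in> ring_verts m. (v \<in> S) \<noteq> \<beta>} \<subseteq> vx i ` {r \<in> {..<8}. (vx i r \<in> S) \<noteq> \<beta>}"
      using outside unfolding ring_verts_def by blast
    then have "card {v \<in> ring_verts m. (v \<in> S) \<noteq> \<beta>} \<le> card (vx i ` {r \<in> {..<8}. (vx i r \<in> S) \<noteq> \<beta>})"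
      by (intro card_mono) auto
    also have "\<dots> \<le> 1" using one card_image_le[of "{r \<in> {..<8}. (vx i r \<in> S) \<noteq> \<beta>}" "vx i"] by simp
    finally have le: "card {v \<in> ring_verts m. (v \<in> S) \<noteq> \<beta>} \<le> 1" .
    show ?thesis
    proof (cases \<beta>)
      case True
      then have "{v \<in> ring_verts m. (v \<in> S) \<noteq> \<beta>} = ring_verts m - S" by blast
      with le show ?thesis by simp
    next
      case False
      then have "{v \<in> ring_verts m. (v \<in> S) \<noteq> \<beta>} = S" using S by blast
      with le show ?thesis by simp
    qed
  qed
qed

section \<open>Components and cyclic edge connectivity\<close>

lemma components_disjoint:
  assumes "C \<in> components V E" "D \<in> components V E" "C \<noteq> D"
  shows "C \<inter> D = {}"
proof -
  let ?R = "{(x, y). {x, y} \<in> E}\<^sup>*"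
  have "sym {(x, y). {x, y} \<in> E}" by (auto simp: sym_def insert_commute)
  then have sym: "sym ?R" by (rule sym_rtrancl)
  obtain c d where C: "C = {v \<in> V. (c, v) \<in> ?R}" and D: "D = {v \<in> V. (d, v) \<in> ?R}"
    using assms by (auto simp: components_def)
  show ?thesis
  proof (rule ccontr)
    assume "C \<inter> D \<noteq> {}"
    then obtain v where "(c, v) \<in> ?R" "(d, v) \<in> ?R" using C D by blast
    then have "(c, d) \<in> ?R" "(d, c) \<in> ?R" using sym by (meson rtrancl_trans symD)+
    then have "C = D" unfolding C D by (meson rtrancl_trans Collect_cong)
    with assms(3) show False by simp
  qed
qed

text \<open>A surviving edge leaving \<open>C\<close> would extend a path inside the component
  beyond it.\<close>

lemma cut_component_subset:
  assumes "simple_graph V E" "C \<in> components V (E - F)"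
  shows "edge_cut E C \<subseteq> F"
proof
  fix e assume "e \<in> edge_cut E C"
  then obtain x y where e: "e \<in> E" "e = {x, y}" "x \<in> C" "y \<notin> C" by (auto simp: edge_cut_def)
  obtain c where C: "C = {v \<in> V. (c, v) \<in> {(x, y). {x, y} \<in> E - F}\<^sup>*}"
    using assms(2) by (auto simp: components_def)
  have "y \<in> V" using e assms(1) by (auto simp: simple_graph_def)
  show "e \<in> F"
  proof (rule ccontr)
    assume "e \<notin> F"
    then have "(x, y) \<in> {(x, y). {x, y} \<in> E - F}" using e by simp
    then have "y \<in> C" using e(3) \<open>y \<in> V\<close> unfolding C by (auto intro: rtrancl_into_rtrancl)
    with e(4) show False by simp
  qed
qed

lemma contains_cycle_card:
  assumes "contains_cycle E C" "finite C"
  shows "3 \<le> card C"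
proof -
  obtain xs where "length xs \<ge> 3" "distinct xs" "set xs \<subseteq> C"
    using assms(1) by (auto simp: contains_cycle_def is_cycle_def)
  then show ?thesis using card_mono[OF assms(2), of "set xs"] by (simp add: distinct_card)
qed

text \<open>\<open>F\<close> contains the edge cut of \<open>C\<close>. A cycle has at least three
  vertices, so \<open>C\<close> and its complement, which contains \<open>D\<close>, are both too
  large for the trivial cuts of \<open>small_cut_trivial\<close>.\<close>

lemma cyclically_4_edge_connected_ring:
  assumes "m \<ge> 2"
  shows "cyclically_edge_connected 4 (ring_verts m) (ring_edges m)"
  unfolding cyclically_edge_connected_def
proof (intro allI impI)
  let ?V = "ring_verts m" and ?E = "ring_edges m"
  fix F assume F: "F \<subseteq> ?E"
  assume "\<exists>C\<in>components ?V (?E - F). \<exists>D\<in>components ?V (?E - F).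
    C \<noteq> D \<and> contains_cycle (?E - F) C \<and> contains_cycle (?E - F) D"
  then obtain C D where CD: "C \<in> components ?V (?E - F)" "D \<in> components ?V (?E - F)" "C \<noteq> D"
    "contains_cycle (?E - F) C" "contains_cycle (?E - F) D" by blast
  have sub: "C \<subseteq> ?V" "D \<subseteq> ?V" using CD by (auto simp: components_def)
  have fin: "finite ?V" by (simp add: ring_verts_eq)
  have "D \<subseteq> ?V - C" using components_disjoint[OF CD(1-3)] sub by blast
  then have "card D \<le> card (?V - C)" using fin by (intro card_mono) auto
  moreover have "3 \<le> card C" "3 \<le> card D"
    using CD sub fin contains_cycle_card finite_subset by metis+
  ultimately have "4 \<le> card (edge_cut ?E C)"
    using small_cut_trivial[OF assms sub(1)] by linarith
  also have "\<dots> \<le> card F"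
    using cut_component_subset[OF _ CD(1)] cubic_ring[OF assms] F finite_ring_edges
    by (intro card_mono) (auto simp: cubic_graph_def intro: finite_subset)
  finally show "4 \<le> card F" .
qed

theorem theorem1:
  fixes m :: nat
  assumes "m \<ge> 2"
  shows "\<exists>(V :: nat set) (E :: nat set set).
           cubic_graph V E \<and> cyclically_edge_connected 4 V E \<and>
           card V = 8 * m \<and> circumference E = 7 * m + 2"
proof (intro exI conjI)
  show "cubic_graph (ring_verts m) (ring_edges m)" by (rule cubic_ring[OF assms])
  show "cyclically_edge_connected 4 (ring_verts m) (ring_edges m)"
    by (rule cyclically_4_edge_connected_ring[OF assms])
  show "card (ring_verts m) = 8 * m" by (simp add: ring_verts_eq)
  show "circumference (ring_edges m) = 7 * m + 2" by (rule circumference_ring[OF assms])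
qed

end
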